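(* Let $R$ be a topological ring and let $X$ be a non-trivial Bohr separated semitopological $R$-module. If the completion $\breve R$ of $R$ is an overcrowded topological ring, then the Bohr modification $X^{\flat}$ of $X$ is not a topological $R$-module. Moreover, for any non-zero element $x\in X$ the homomorphism $R\to X^{\flat}$, $r\mapsto r*x$, is not a topological embedding.
   Context: A topological ring is a unital ring $R$ (not necessarily commutative) with a Hausdorff topology making addition and multiplication jointly continuous. Its completion $\breve R$ is the Raĭkov completion of the additive topological group of $R$, i.e. the complete Hausdorff topological group containing $R$ as a dense subgroup, endowed with the unique continuous extension of the multiplication of $R$, which makes it a topological ring. A semitopological (resp. topological) $R$-module is a unital left $R$-module $X$ endowed with a Hausdorff topology making $X$ an Abelian topological group and making the multiplication $*:R\times X\to X$ separately (resp. jointly) continuous. It is non-trivial if $X\neq\{0\}$. The Bohr topology on a topological group $X$ is the smallest topology $\tau$ on $X$ such that every continuous homomorphism from $X$ (with its original topology) to a Hausdorff compact topological group remains continuous with respect to $\tau$. The group $X$ endowed with its Bohr topology is denoted $X^{\flat}$ and called the Bohr modification of $X$ (for a module $X$, with the same $R$-module structure). $X$ is Bohr separated if its Bohr topology is Hausdorff. A topological ring $R$ is crowded if every neighborhood of zero in $R$ contains an invertible (two-sided) element. It is overcrowded if it is crowded and for every $n\in\mathbb N$ there is a set $A\subseteq R$ of cardinality $|A|=n$ such that for any distinct $a,b\in A$ the element $a-b$ is invertible in $R$. *)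

theory Defs
  imports "HOL-Analysis.Analysis" "HOL-Algebra.Module"
begin

text \<open>Topological groups are not assumed to be Hausdorff or commutative here.\<close>

locale topological_group = group G for G (structure) and T +
  assumes topspace_eq: "topspace T = carrier G"
    and continuous_mult: "continuous_map (prod_topology T T) T (\<lambda>(x, y). x \<otimes> y)"
    and continuous_inv: "continuous_map T T (\<lambda>x. inv x)"

text \<open>Raikov completeness, i.e. completeness of the two-sided uniformity.\<close>

definition raikov_complete :: "('a, 'm) monoid_scheme \<Rightarrow> 'a topology \<Rightarrow> bool" where
  "raikov_complete G T \<longleftrightarrow>
     (\<forall>F. F \<noteq> bot \<and> eventually (\<lambda>x. x \<in> carrier G) F \<and>
          (\<forall>U. openin T U \<and> \<one>\<^bsub>G\<^esub> \<in> U \<longrightarrow>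
             (\<exists>A \<subseteq> carrier G. eventually (\<lambda>x. x \<in> A) F \<and>
                (\<forall>x \<in> A. \<forall>y \<in> A. inv\<^bsub>G\<^esub> x \<otimes>\<^bsub>G\<^esub> y \<in> U \<and> x \<otimes>\<^bsub>G\<^esub> inv\<^bsub>G\<^esub> y \<in> U)))
        \<longrightarrow> (\<exists>l. limitin T (\<lambda>x. x) l F))"

locale topological_ring = ring R for R (structure) and T +
  assumes topspace_eq: "topspace T = carrier R"
    and Hausdorff: "Hausdorff_space T"
    and continuous_add: "continuous_map (prod_topology T T) T (\<lambda>(x, y). x \<oplus> y)"
    and continuous_mult: "continuous_map (prod_topology T T) T (\<lambda>(x, y). x \<otimes> y)"

text \<open>
  \<open>(C, TC)\<close> is a completion of the topological ring \<open>(R, TR)\<close>, which is regarded as a dense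
  subring by means of \<open>i\<close>. This determines \<open>(C, TC, i)\<close> up to a unique topological isomorphism:
  the additive group is the Raikov completion of that of \<open>R\<close>, and by density the multiplication
  is the only continuous extension of that of \<open>R\<close>.
\<close>

definition is_completion ::
  "('r, 'm) ring_scheme \<Rightarrow> 'r topology \<Rightarrow> ('c, 'k) ring_scheme \<Rightarrow> 'c topology \<Rightarrow> ('r \<Rightarrow> 'c) \<Rightarrow> bool"
  where
  "is_completion R TR C TC i \<longleftrightarrow>
     topological_ring C TC \<and> raikov_complete (add_monoid C) TC \<and>
     i \<in> ring_hom R C \<and> embedding_map TR TC i \<and>
     TC closure_of (i ` carrier R) = carrier C"

definition crowded :: "('r, 'm) ring_scheme \<Rightarrow> 'r topology \<Rightarrow> bool" where
  "crowded R T \<longleftrightarrow> (\<forall>U. openin T U \<and> \<zero>\<^bsub>R\<^esub> \<in> U \<longrightarrow> (\<exists>u \<in> U. u \<in> Units R))"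

definition overcrowded :: "('r, 'm) ring_scheme \<Rightarrow> 'r topology \<Rightarrow> bool" where
  "overcrowded R T \<longleftrightarrow> crowded R T \<and>
     (\<forall>n::nat. \<exists>A \<subseteq> carrier R. finite A \<and> card A = n \<and>
        (\<forall>a \<in> A. \<forall>b \<in> A. a \<noteq> b \<longrightarrow> a \<ominus>\<^bsub>R\<^esub> b \<in> Units R))"

text \<open>
  Unital left modules over a not necessarily commutative ring; the library's locale
  \<open>module\<close> has the same axioms but requires a commutative ring.
\<close>

locale left_module = R?: ring R + M?: abelian_group M for R (structure) and M (structure) +
  assumes smult_closed [simp, intro]:
      "\<lbrakk>a \<in> carrier R; x \<in> carrier M\<rbrakk> \<Longrightarrow> a \<odot>\<^bsub>M\<^esub> x \<in> carrier M"
    and smult_l_distr: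
      "\<lbrakk>a \<in> carrier R; b \<in> carrier R; x \<in> carrier M\<rbrakk> \<Longrightarrow>
       (a \<oplus>\<^bsub>R\<^esub> b) \<odot>\<^bsub>M\<^esub> x = a \<odot>\<^bsub>M\<^esub> x \<oplus>\<^bsub>M\<^esub> b \<odot>\<^bsub>M\<^esub> x"
    and smult_r_distr:
      "\<lbrakk>a \<in> carrier R; x \<in> carrier M; y \<in> carrier M\<rbrakk> \<Longrightarrow>
       a \<odot>\<^bsub>M\<^esub> (x \<oplus>\<^bsub>M\<^esub> y) = a \<odot>\<^bsub>M\<^esub> x \<oplus>\<^bsub>M\<^esub> a \<odot>\<^bsub>M\<^esub> y"
    and smult_assoc1:
      "\<lbrakk>a \<in> carrier R; b \<in> carrier R; x \<in> carrier M\<rbrakk> \<Longrightarrow>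
       (a \<otimes>\<^bsub>R\<^esub> b) \<odot>\<^bsub>M\<^esub> x = a \<odot>\<^bsub>M\<^esub> (b \<odot>\<^bsub>M\<^esub> x)"
    and smult_one [simp]: "x \<in> carrier M \<Longrightarrow> \<one>\<^bsub>R\<^esub> \<odot>\<^bsub>M\<^esub> x = x"

definition semitopological_module ::
  "('r, 'm) ring_scheme \<Rightarrow> 'r topology \<Rightarrow> ('r, 'x, 'n) module_scheme \<Rightarrow> 'x topology \<Rightarrow> bool" where
  "semitopological_module R TR X TX \<longleftrightarrow>
     left_module R X \<and> topological_group (add_monoid X) TX \<and> Hausdorff_space TX \<and>
     (\<forall>r \<in> carrier R. continuous_map TX TX (\<lambda>x. r \<odot>\<^bsub>X\<^esub> x)) \<and>
     (\<forall>x \<in> carrier X. continuous_map TR TX (\<lambda>r. r \<odot>\<^bsub>X\<^esub> x))"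

definition topological_module ::
  "('r, 'm) ring_scheme \<Rightarrow> 'r topology \<Rightarrow> ('r, 'x, 'n) module_scheme \<Rightarrow> 'x topology \<Rightarrow> bool" where
  "topological_module R TR X TX \<longleftrightarrow>
     left_module R X \<and> topological_group (add_monoid X) TX \<and> Hausdorff_space TX \<and>
     continuous_map (prod_topology TR TX) TX (\<lambda>(r, x). r \<odot>\<^bsub>X\<^esub> x)"

text \<open>
  HOL cannot quantify over the groups \<open>K\<close> of all types inside a formula, so the definition of
  the Bohr topology lets \<open>K\<close> range over the compact Hausdorff groups with elements in
  \<open>'a set set\<close>. This is no restriction: if \<open>f\<close> is a homomorphism from \<open>G\<close> to a compact Hausdorff
  group over any type, then the closure of its image embeds into \<open>'a set set\<close>.
  The lemmas \<open>continuous_map_bohr\<close> and \<open>bohr_topology_smallest\<close> below show that the topology so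
  defined is the smallest one for which every continuous homomorphism to a compact Hausdorff
  group, of whatever type, remains continuous.
\<close>

definition bohr_topology :: "('a, 'm) monoid_scheme \<Rightarrow> 'a topology \<Rightarrow> 'a topology" where
  "bohr_topology G T = topology_generated_by
     {{x \<in> carrier G. f x \<in> U} | f U (K :: 'a set set monoid) TK.
        topological_group K TK \<and> compact_space TK \<and> Hausdorff_space TK \<and>
        f \<in> hom G K \<and> continuous_map T TK f \<and> openin TK U}"

definition bohr_separated :: "('a, 'm) monoid_scheme \<Rightarrow> 'a topology \<Rightarrow> bool" where
  "bohr_separated G T \<longleftrightarrow> Hausdorff_space (bohr_topology G T)"

lemma bohr_topology_smallest:
  fixes G :: "('a, 'm) monoid_scheme"
  assumes "topspace S = carrier G"
    and S: "\<And>(K :: 'a set set monoid) TK f.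
      \<lbrakk>topological_group K TK; compact_space TK; Hausdorff_space TK;
       f \<in> hom G K; continuous_map T TK f\<rbrakk> \<Longrightarrow> continuous_map S TK f"
    and U: "openin (bohr_topology G T) U"
  shows "openin S U"
proof (rule generate_topology_on_coarsest[OF istopology_openin _
      openin_topology_generated_by[OF U[unfolded bohr_topology_def]]])
  fix V
  assume "V \<in> {{x \<in> carrier G. f x \<in> U} | f U (K :: 'a set set monoid) TK.
        topological_group K TK \<and> compact_space TK \<and> Hausdorff_space TK \<and>
        f \<in> hom G K \<and> continuous_map T TK f \<and> openin TK U}"
  then show "openin S V"
    using S assms(1) by (force simp: continuous_map_def)
qed

lemma continuous_map_bohr_small:
  fixes K :: "'a set set monoid" and G :: "('a, 'm) monoid_scheme"
  assumes "topological_group K TK" "compact_space TK" "Hausdorff_space TK"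
    and f: "f \<in> hom G K" "continuous_map T TK f"
  shows "continuous_map (bohr_topology G T) TK f"
proof -
  have op: "openin (bohr_topology G T) {x \<in> carrier G. f x \<in> U}" if "openin TK U" for U
    unfolding bohr_topology_def
    by (rule topology_generated_by_Basis) (use assms that in blast)
  have sub: "topspace (bohr_topology G T) \<subseteq> carrier G"
    unfolding bohr_topology_def by auto
  have K: "topspace TK = carrier K"
    using assms(1) by (rule topological_group.topspace_eq)
  have "{x \<in> carrier G. f x \<in> topspace TK} = carrier G"
    using f(1) K by (auto simp: hom_def)
  then have "carrier G \<subseteq> topspace (bohr_topology G T)"
    using op[OF openin_topspace] openin_subset by metis
  with sub have "topspace (bohr_topology G T) = carrier G" by blast
  then show ?thesis
    using op f(1) K by (auto simp: continuous_map_def hom_def)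
qed

lemma topspace_bohr_topology:
  fixes G :: "('a, 'm) monoid_scheme"
  assumes "topological_group G T"
  shows "topspace (bohr_topology G T) = carrier G"
proof
  show "topspace (bohr_topology G T) \<subseteq> carrier G"
    unfolding bohr_topology_def by auto
  define K :: "'a set set monoid" where "K = \<lparr>carrier = {{}}, mult = (\<lambda>_ _. {}), one = {}\<rparr>"
  have gK: "group K"
    by (rule groupI) (auto simp: K_def)
  have tK: "topological_group K (discrete_topology {{}})"
  proof (intro topological_group.intro topological_group_axioms.intro gK)
    have inv: "inv\<^bsub>K\<^esub> x = {}" if "x \<in> carrier K" for x
      using group.inv_closed[OF gK that] by (simp add: K_def)
    show "continuous_map (discrete_topology {{}}) (discrete_topology {{}}) (m_inv K)"
      using inv by (auto simp: K_def continuous_map_from_discrete_topology)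
    show "continuous_map (prod_topology (discrete_topology {{}}) (discrete_topology {{}}))
            (discrete_topology {{}}) (\<lambda>(x, y). x \<otimes>\<^bsub>K\<^esub> y)"
      by (auto simp: K_def split_def)
  qed (simp add: K_def)
  have "openin (bohr_topology G T) {x \<in> carrier G. (\<lambda>_. {}) x \<in> {{} :: 'a set set}}"
    unfolding bohr_topology_def
  proof (rule topology_generated_by_Basis, rule CollectI,
      rule exI[of _ "\<lambda>_. {}"], rule exI[of _ "{{}}"], rule exI[of _ K],
      rule exI[of _ "discrete_topology {{}}"], intro conjI refl)
    show "topological_group K (discrete_topology {{}})" by (rule tK)
    show "(\<lambda>_. {}) \<in> hom G K" by (simp add: hom_def K_def)
    show "compact_space (discrete_topology {{} :: 'a set set})"
      by (simp add: compact_space_discrete_topology)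
    show "Hausdorff_space (discrete_topology {{} :: 'a set set})"
      by (rule Hausdorff_space_discrete_topology)
    show "continuous_map T (discrete_topology {{}}) (\<lambda>_. {} :: 'a set set)" by simp
    show "openin (discrete_topology {{} :: 'a set set}) {{}}" by simp
  qed
  then have "openin (bohr_topology G T) (carrier G)" by simp
  then show "carrier G \<subseteq> topspace (bohr_topology G T)"
    by (rule openin_subset)
qed

lemma subgroup_closure_of:
  assumes "topological_group K TK" and H: "subgroup H K"
  shows "subgroup (TK closure_of H) K"
proof -
  interpret topological_group K TK by fact
  let ?D = "TK closure_of H"
  show ?thesis
  proof (rule subgroupI)
    show "?D \<subseteq> carrier K"
      using closure_of_subset_topspace topspace_eq by metis
    have "H \<subseteq> ?D"
      using subgroup.subset[OF H] topspace_eq by (simp add: closure_of_subset)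
    then show "?D \<noteq> {}"
      using subgroup.one_closed[OF H] by blast
    show "inv\<^bsub>K\<^esub> x \<in> ?D" if "x \<in> ?D" for x
    proof -
      have "inv\<^bsub>K\<^esub> x \<in> TK closure_of ((\<lambda>x. inv\<^bsub>K\<^esub> x) ` H)"
        using continuous_map_image_closure_subset[OF continuous_inv, of H] that by blast
      moreover have "(\<lambda>x. inv\<^bsub>K\<^esub> x) ` H \<subseteq> H"
        using subgroup.m_inv_closed[OF H] by blast
      ultimately show ?thesis using closure_of_mono by blast
    qed
    show "x \<otimes>\<^bsub>K\<^esub> y \<in> ?D" if "x \<in> ?D" "y \<in> ?D" for x y
    proof -
      have "(x, y) \<in> prod_topology TK TK closure_of (H \<times> H)"
        using that by (simp add: closure_of_Times)
      then have "x \<otimes>\<^bsub>K\<^esub> y \<in> TK closure_of ((\<lambda>(x, y). x \<otimes>\<^bsub>K\<^esub> y) ` (H \<times> H))"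
        using continuous_map_image_closure_subset[OF continuous_mult, of "H \<times> H"] by force
      moreover have "(\<lambda>(x, y). x \<otimes>\<^bsub>K\<^esub> y) ` (H \<times> H) \<subseteq> H"
        using subgroup.m_closed[OF H] by auto
      ultimately show ?thesis using closure_of_mono by blast
    qed
  qed
qed

lemma continuous_map_bohr:
  fixes G :: "('a, 'm) monoid_scheme" and K :: "('k, 'l) monoid_scheme"
  assumes G: "topological_group G T"
    and K: "topological_group K TK" "compact_space TK" "Hausdorff_space TK"
    and f: "f \<in> hom G K" "continuous_map T TK f"
  shows "continuous_map (bohr_topology G T) TK f"
proof -
  interpret G: topological_group G T by fact
  interpret K: topological_group K TK by fact
  interpret fh: group_hom G K f
    by unfold_locales (rule f(1))
  define H where "H = f ` carrier G"
  define D where "D = TK closure_of H"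
  have subH: "subgroup H K"
    unfolding H_def by (rule fh.img_is_subgroup)
  have subD: "subgroup D K"
    unfolding D_def by (rule subgroup_closure_of[OF K(1) subH])
  have DK: "D \<subseteq> carrier K" by (rule subgroup.subset[OF subD])
  have fD: "f x \<in> D" if "x \<in> carrier G" for x
    using that subgroup.subset[OF subH] closure_of_subset[of H TK] K.topspace_eq
    by (auto simp: D_def H_def)
  define e :: "'k \<Rightarrow> 'a set set" where "e k = {A. A \<subseteq> carrier G \<and> k \<in> TK closure_of (f ` A)}" for k
  have inj: "inj_on e D"
  proof (rule inj_onI, rule ccontr)
    fix k l assume kl: "k \<in> D" "l \<in> D" "e k = e l" "k \<noteq> l"
    then have "k \<in> topspace TK" "l \<in> topspace TK"
      using DK K.topspace_eq by auto
    then obtain U V where UV: "openin TK U" "openin TK V" "k \<in> U" "l \<in> V" "disjnt U V"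
      using K(3) kl(4) unfolding Hausdorff_space_def by meson
    define A where "A = {x \<in> carrier G. f x \<in> U}"
    have "k \<in> TK closure_of (f ` A)"
      unfolding in_closure_of
    proof (intro conjI allI impI)
      show "k \<in> topspace TK" by fact
      fix W assume W: "k \<in> W \<and> openin TK W"
      then have "openin TK (W \<inter> U)" "k \<in> W \<inter> U"
        using UV by auto
      then obtain y where "y \<in> H" "y \<in> W \<inter> U"
        using kl(1) unfolding D_def in_closure_of by blast
      then show "\<exists>y. y \<in> f ` A \<and> y \<in> W"
        by (auto simp: H_def A_def)
    qed
    then have "A \<in> e k" by (simp add: e_def A_def)
    then have "A \<in> e l" using kl(3) by simp
    then have "l \<in> TK closure_of (f ` A)" by (simp add: e_def)
    then obtain y where "y \<in> f ` A" "y \<in> V"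
      using UV unfolding in_closure_of by blast
    then show False using UV(5) by (auto simp: A_def disjnt_iff)
  qed
  define d where "d = inv_into D e"
  have de: "d (e k) = k" if "k \<in> D" for k
    using that inj by (simp add: d_def)
  define L where
    "L = \<lparr>carrier = e ` D, mult = (\<lambda>a b. e (d a \<otimes>\<^bsub>K\<^esub> d b)), one = e \<one>\<^bsub>K\<^esub>\<rparr>"
  define TL where "TL = pullback_topology (e ` D) d TK"
  note Dcl = subgroup.m_closed[OF subD] subgroup.m_inv_closed[OF subD] subgroup.one_closed[OF subD]
  have assoc: "x \<otimes>\<^bsub>K\<^esub> y \<otimes>\<^bsub>K\<^esub> z = x \<otimes>\<^bsub>K\<^esub> (y \<otimes>\<^bsub>K\<^esub> z)" if "x \<in> D" "y \<in> D" "z \<in> D" for x y z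
    using that DK by (intro K.m_assoc) auto
  have linv: "inv\<^bsub>K\<^esub> x \<otimes>\<^bsub>K\<^esub> x = \<one>\<^bsub>K\<^esub>" if "x \<in> D" for x
    using that DK by (intro K.l_inv) auto
  have lone: "\<one>\<^bsub>K\<^esub> \<otimes>\<^bsub>K\<^esub> x = x" if "x \<in> D" for x
    using that DK by (intro K.l_one) auto
  have gL: "group L"
  proof (rule groupI)
    fix x assume "x \<in> carrier L"
    then obtain k where k: "k \<in> D" "x = e k" by (auto simp: L_def)
    then have "e (inv\<^bsub>K\<^esub> k) \<in> carrier L" "e (inv\<^bsub>K\<^esub> k) \<otimes>\<^bsub>L\<^esub> x = \<one>\<^bsub>L\<^esub>"
      by (auto simp: L_def de Dcl linv)
    then show "\<exists>y\<in>carrier L. y \<otimes>\<^bsub>L\<^esub> x = \<one>\<^bsub>L\<^esub>" by blast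
  qed (auto simp: L_def de Dcl assoc lone)
  have invL: "inv\<^bsub>L\<^esub> (e k) = e (inv\<^bsub>K\<^esub> k)" if "k \<in> D" for k
    using that by (intro group.inv_equality[OF gL]) (auto simp: L_def de Dcl linv)
  have topL: "topspace TL = e ` D"
    using DK K.topspace_eq by (auto simp: TL_def topspace_pullback_topology de)
  have cd: "continuous_map TL TK d"
    using continuous_map_pullback[OF continuous_map_id[of TK], of "e ` D" d] by (simp add: TL_def)
  have cint: "continuous_map Z TL g"
    if "continuous_map Z TK h" "\<And>z. z \<in> topspace Z \<Longrightarrow> g z \<in> e ` D \<and> d (g z) = h z" for Z :: "'z topology" and g h
    unfolding TL_def
  proof (rule continuous_map_pullback')
    show "continuous_map Z TK (d \<circ> g)"
      by (rule continuous_map_eq[OF that(1)]) (use that(2) in auto)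
    show "topspace Z \<subseteq> g -` (e ` D)"
      using that(2) by (simp add: subset_iff)
  qed
  have tL: "topological_group L TL"
  proof (intro topological_group.intro topological_group_axioms.intro gL)
    show "topspace TL = carrier L" by (simp add: topL L_def)
    have "continuous_map (prod_topology TL TL) (prod_topology TK TK) (\<lambda>z. (d (fst z), d (snd z)))"
      by (intro continuous_map_pairedI continuous_map_compose[OF continuous_map_fst cd, unfolded o_def]
          continuous_map_compose[OF continuous_map_snd cd, unfolded o_def])
    from continuous_map_compose[OF this K.continuous_mult]
    have "continuous_map (prod_topology TL TL) TK (\<lambda>z. d (fst z) \<otimes>\<^bsub>K\<^esub> d (snd z))"
      by (simp add: o_def)
    then show "continuous_map (prod_topology TL TL) TL (\<lambda>(x, y). x \<otimes>\<^bsub>L\<^esub> y)"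
      by (rule cint) (auto simp: topL L_def de Dcl)
    have "continuous_map TL TK (\<lambda>x. inv\<^bsub>K\<^esub> d x)"
      using continuous_map_compose[OF cd K.continuous_inv] by (simp add: o_def)
    then show "continuous_map TL TL (\<lambda>x. inv\<^bsub>L\<^esub> x)"
      by (rule cint) (auto simp: topL invL de Dcl)
  qed
  have "compactin TK D"
    using K(2) by (simp add: D_def closedin_compact_space)
  then have "compact_space (subtopology TK D)"
    by (rule compact_space_subtopology)
  moreover have ce: "continuous_map (subtopology TK D) TL e"
    by (rule cint[of _ "\<lambda>x. x"]) (auto simp: de)
  moreover have "e ` topspace (subtopology TK D) = topspace TL"
    using DK K.topspace_eq by (auto simp: topL)
  ultimately have "compact_space TL"
    unfolding compact_space_def using image_compactin by metis
  moreover have "Hausdorff_space TL"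
    by (rule Hausdorff_space_injective_preimage[OF K(3) cd])
      (auto simp: topL inj_on_def de)
  moreover have "(\<lambda>x. e (f x)) \<in> hom G L"
    using fD by (auto simp: hom_def L_def de)
  moreover have "continuous_map T TL (\<lambda>x. e (f x))"
    by (rule cint[OF f(2)]) (use fD G.topspace_eq in \<open>auto simp: de\<close>)
  ultimately have "continuous_map (bohr_topology G T) TL (\<lambda>x. e (f x))"
    using tL by (intro continuous_map_bohr_small)
  from continuous_map_compose[OF this cd]
  show ?thesis
    by (rule continuous_map_eq) (use fD topspace_bohr_topology[OF G] in \<open>auto simp: de\<close>)
qed

end

theory Submission
  imports Defs "HOL-Algebra.RingHom"
begin

text \<open>
  The Bohr topology is totally bounded, because the compact groups that generate it are. The
  theorem therefore follows from one fact, \<open>totally_bounded_module_trivial\<close>: if \<open>R\<close> is dense in a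
  crowded topological ring, then every totally bounded topological \<open>R\<close>-module \<open>M\<close> is trivial.

  To see why, suppose first that \<open>R\<close> itself is crowded. Total boundedness provides for every
  neighborhood \<open>U\<close> of zero in \<open>M\<close> a neighborhood \<open>V\<close> of zero in \<open>R\<close> with \<open>V * M \<subseteq> U\<close>
  (\<open>totally_bounded_module_bounded\<close>). A unit \<open>u \<in> V\<close> yields \<open>M = u * M \<subseteq> U\<close>; hence
  \<open>M\<close> lies in every neighborhood of zero, and is trivial since it is Hausdorff. If only a ring
  containing \<open>R\<close> as a dense subring is crowded, approximate \<open>u\<close> and its inverse by elements \<open>r, s\<close>
  of \<open>R\<close>. Then \<open>r\<close> and \<open>r * s - 1\<close> both lie in \<open>V\<close>, and \<open>x = r * (s * x) - (r * s - 1) * x\<close>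
  shows \<open>M \<subseteq> U - U\<close>, which serves just as well.

  The Bohr modification of a non-trivial module thus cannot be a topological module. Moreover, if
  \<open>r \<mapsto> r * x\<close> embeds \<open>R\<close> into the Bohr modification, then \<open>R\<close> is totally bounded. As a module over
  itself it is then trivial, so \<open>x = 1 * x = 0 * x = 0\<close>.
\<close>

section \<open>Totally bounded groups\<close>

text \<open>
  Total boundedness is expressed by covers with small sets instead of finitely many translates of
  \<open>U\<close>: such covers have common refinements and pull back along homomorphisms, whereas
  the centers of the translates would have to be chosen anew.
\<close>

definition finite_small_cover :: "('a, 'm) monoid_scheme \<Rightarrow> 'a set \<Rightarrow> bool" where
  "finite_small_cover G U \<longleftrightarrow>
     (\<exists>\<A>. finite \<A> \<and> \<Union>\<A> = carrier G \<and>
        (\<forall>A \<in> \<A>. \<forall>x \<in> A. \<forall>y \<in> A. x \<otimes>\<^bsub>G\<^esub> inv\<^bsub>G\<^esub> y \<in> U))"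

definition totally_bounded_group :: "('a, 'm) monoid_scheme \<Rightarrow> 'a topology \<Rightarrow> bool" where
  "totally_bounded_group G T \<longleftrightarrow> (\<forall>U. openin T U \<and> \<one>\<^bsub>G\<^esub> \<in> U \<longrightarrow> finite_small_cover G U)"

lemma finite_small_cover_mono:
  "finite_small_cover G U \<Longrightarrow> U \<subseteq> V \<Longrightarrow> finite_small_cover G V"
  unfolding finite_small_cover_def by (meson subsetD)

lemma finite_small_cover_Int:
  assumes "finite_small_cover G U" "finite_small_cover G V"
  shows "finite_small_cover G (U \<inter> V)"
proof -
  obtain \<A> where A: "finite \<A>" "\<Union>\<A> = carrier G"
    "\<forall>A \<in> \<A>. \<forall>x \<in> A. \<forall>y \<in> A. x \<otimes>\<^bsub>G\<^esub> inv\<^bsub>G\<^esub> y \<in> U"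
    using assms(1) unfolding finite_small_cover_def by meson
  obtain \<B> where B: "finite \<B>" "\<Union>\<B> = carrier G"
    "\<forall>A \<in> \<B>. \<forall>x \<in> A. \<forall>y \<in> A. x \<otimes>\<^bsub>G\<^esub> inv\<^bsub>G\<^esub> y \<in> V"
    using assms(2) unfolding finite_small_cover_def by meson
  let ?C = "(\<lambda>(A, B). A \<inter> B) ` (\<A> \<times> \<B>)"
  have "finite ?C" using A(1) B(1) by simp
  moreover have "\<Union>?C = \<Union>\<A> \<inter> \<Union>\<B>" by auto
  then have "\<Union>?C = carrier G" using A(2) B(2) by simp
  moreover have "\<forall>A \<in> ?C. \<forall>x \<in> A. \<forall>y \<in> A. x \<otimes>\<^bsub>G\<^esub> inv\<^bsub>G\<^esub> y \<in> U \<inter> V"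
    using A(3) B(3) by auto
  ultimately show ?thesis unfolding finite_small_cover_def by (intro exI[of _ ?C] conjI)
qed

lemma finite_small_cover_hom_preimage:
  assumes "group G" "group H" and f: "f \<in> hom G H" and U: "finite_small_cover H U"
  shows "finite_small_cover G {x \<in> carrier G. f x \<in> U}"
proof -
  interpret group_hom G H f
    using assms by (simp add: group_hom_def group_hom_axioms_def)
  obtain \<A> where A: "finite \<A>" "\<Union>\<A> = carrier H"
    "\<forall>A \<in> \<A>. \<forall>x \<in> A. \<forall>y \<in> A. x \<otimes>\<^bsub>H\<^esub> inv\<^bsub>H\<^esub> y \<in> U"
    using U unfolding finite_small_cover_def by meson
  let ?C = "(\<lambda>A. {x \<in> carrier G. f x \<in> A}) ` \<A>"
  have "finite ?C" using A(1) by simp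
  moreover have "\<Union>?C = carrier G" using A(2) hom_closed by auto
  moreover have "\<forall>A \<in> ?C. \<forall>x \<in> A. \<forall>y \<in> A. x \<otimes>\<^bsub>G\<^esub> inv\<^bsub>G\<^esub> y \<in> {x \<in> carrier G. f x \<in> U}"
    using A(3) by auto
  ultimately show ?thesis unfolding finite_small_cover_def by (intro exI[of _ ?C] conjI)
qed

lemma continuous_map_binary_neighborhoods:
  assumes f: "continuous_map (prod_topology S T) Z (\<lambda>(x, y). f x y)"
    and "x \<in> topspace S" "y \<in> topspace T" "openin Z W" "f x y \<in> W"
  obtains U V where "openin S U" "openin T V" "x \<in> U" "y \<in> V"
    "\<And>u v. u \<in> U \<Longrightarrow> v \<in> V \<Longrightarrow> f u v \<in> W"
proof -
  let ?P = "{z \<in> topspace (prod_topology S T). (\<lambda>(x, y). f x y) z \<in> W}"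
  have "openin (prod_topology S T) ?P" "(x, y) \<in> ?P"
    using openin_continuous_map_preimage[OF f assms(4)] assms by auto
  then obtain U V where UV: "openin S U" "openin T V" "x \<in> U" "y \<in> V" "U \<times> V \<subseteq> ?P"
    unfolding openin_prod_topology_alt by meson
  show ?thesis by (rule that[OF UV(1-4)]) (use UV(5) in auto)
qed

lemma (in topological_group) continuous_div:
  "continuous_map (prod_topology T T) T (\<lambda>(x, y). x \<otimes> inv y)"
proof -
  have "continuous_map (prod_topology T T) (prod_topology T T) (\<lambda>z. (fst z, inv (snd z)))"
    by (intro continuous_map_pairedI continuous_map_fst
        continuous_map_compose[OF continuous_map_snd continuous_inv, unfolded o_def])
  from continuous_map_compose[OF this continuous_mult] show ?thesis
    by (simp add: o_def split_def)
qed

lemma compact_imp_totally_bounded_group: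
  assumes "topological_group G T" "compact_space T"
  shows "totally_bounded_group G T"
  unfolding totally_bounded_group_def
proof (intro allI impI)
  interpret topological_group G T by fact
  fix U assume U: "openin T U \<and> \<one>\<^bsub>G\<^esub> \<in> U"
  let ?\<N> = "{N. openin T N \<and> (\<forall>x \<in> N. \<forall>y \<in> N. x \<otimes>\<^bsub>G\<^esub> inv\<^bsub>G\<^esub> y \<in> U)}"
  have "\<exists>N \<in> ?\<N>. k \<in> N" if k: "k \<in> topspace T" for k
  proof -
    have "k \<otimes>\<^bsub>G\<^esub> inv\<^bsub>G\<^esub> k \<in> U" using k U topspace_eq by simp
    then obtain A B where AB: "openin T A" "openin T B" "k \<in> A" "k \<in> B"
      "\<And>a b. a \<in> A \<Longrightarrow> b \<in> B \<Longrightarrow> a \<otimes>\<^bsub>G\<^esub> inv\<^bsub>G\<^esub> b \<in> U"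
      using continuous_map_binary_neighborhoods[OF continuous_div k k, of U] U by metis
    then have "A \<inter> B \<in> ?\<N>" by auto
    then show ?thesis using AB by blast
  qed
  then have "topspace T \<subseteq> \<Union>?\<N>" by blast
  then obtain \<F> where F: "finite \<F>" "\<F> \<subseteq> ?\<N>" "topspace T \<subseteq> \<Union>\<F>"
    using assms(2)[unfolded compact_space_alt, rule_format, of ?\<N>] by auto
  have "\<Union>\<F> \<subseteq> topspace T"
    using F(2) by (intro Union_least openin_subset) auto
  then have "\<Union>\<F> = carrier G"
    using F(3) by (simp add: topspace_eq)
  moreover have "\<forall>N \<in> \<F>. \<forall>x \<in> N. \<forall>y \<in> N. x \<otimes>\<^bsub>G\<^esub> inv\<^bsub>G\<^esub> y \<in> U"
    using F(2) by auto
  ultimately show "finite_small_cover G U"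
    unfolding finite_small_cover_def using F(1) by (intro exI[of _ \<F>] conjI)
qed

text \<open>
  Preimages of open sets of compact groups form only a subbase of the Bohr topology, but the
  existence of small covers is preserved by the operations that generate the topology from it.
\<close>

lemma totally_bounded_bohr_topology:
  fixes G :: "('a, 'm) monoid_scheme"
  assumes "group G"
  shows "totally_bounded_group G (bohr_topology G T)"
  unfolding totally_bounded_group_def
proof (intro allI impI)
  let ?B = "{{x \<in> carrier G. f x \<in> U} | f U (K :: 'a set set monoid) TK.
        topological_group K TK \<and> compact_space TK \<and> Hausdorff_space TK \<and>
        f \<in> hom G K \<and> continuous_map T TK f \<and> openin TK U}"
  fix U assume U: "openin (bohr_topology G T) U \<and> \<one>\<^bsub>G\<^esub> \<in> U"
  then have "generate_topology_on ?B U"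
    unfolding bohr_topology_def by (simp add: openin_topology_generated_by_iff)
  then have "\<one>\<^bsub>G\<^esub> \<in> U \<longrightarrow> finite_small_cover G U"
  proof (induction rule: generate_topology_on.induct)
    case Empty
    then show ?case by simp
  next
    case (Int a b)
    then show ?case by (simp add: finite_small_cover_Int)
  next
    case (UN \<K>)
    then show ?case by (meson Union_iff Union_upper finite_small_cover_mono)
  next
    case (Basis s)
    then obtain f U and K :: "'a set set monoid" and TK where
      s: "s = {x \<in> carrier G. f x \<in> U}"
      and K: "topological_group K TK" "compact_space TK" "openin TK U"
      and f: "f \<in> hom G K"
      by blast
    have gK: "group K" using K(1) by (rule topological_group.axioms)
    show ?case
    proof
      assume "\<one>\<^bsub>G\<^esub> \<in> s"
      then have "\<one>\<^bsub>K\<^esub> \<in> U" using hom_one[OF f assms gK] s by simp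
      then have "finite_small_cover K U"
        using compact_imp_totally_bounded_group[OF K(1,2)] K(3)
        unfolding totally_bounded_group_def by blast
      then show "finite_small_cover G s"
        unfolding s by (rule finite_small_cover_hom_preimage[OF assms gK f])
    qed
  qed
  with U show "finite_small_cover G U" by blast
qed

lemma embedding_map_open_is_preimage:
  assumes "embedding_map S T f" "openin S V"
  obtains W where "openin T W" "V = {x \<in> topspace S. f x \<in> W}"
proof -
  have h: "homeomorphic_map S (subtopology T (f ` topspace S)) f"
    using assms(1) unfolding embedding_map_def .
  have inj: "inj_on f (topspace S)"
    using h by (rule homeomorphic_imp_injective_map)
  have V: "V \<subseteq> topspace S" using assms(2) by (rule openin_subset)
  have "openin (subtopology T (f ` topspace S)) (f ` V)"
    using h V assms(2) homeomorphic_map_openness by blast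
  then obtain W where W: "openin T W" "f ` V = W \<inter> f ` topspace S"
    unfolding openin_subtopology by blast
  have "V = {x \<in> topspace S. f x \<in> W}"
    using W(2) inj V unfolding inj_on_def by blast
  with W(1) show ?thesis by (rule that)
qed

lemma embedding_into_totally_bounded_group:
  assumes G: "group G" "topspace S = carrier G" and H: "group H" "totally_bounded_group H T"
    and f: "f \<in> hom G H" "embedding_map S T f"
  shows "totally_bounded_group G S"
  unfolding totally_bounded_group_def
proof (intro allI impI)
  fix V assume V: "openin S V \<and> \<one>\<^bsub>G\<^esub> \<in> V"
  obtain W where W: "openin T W" "V = {x \<in> topspace S. f x \<in> W}"
    using embedding_map_open_is_preimage[OF f(2)] V by metis
  then have "\<one>\<^bsub>H\<^esub> \<in> W" using V hom_one[OF f(1) G(1) H(1)] by simp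
  then have "finite_small_cover H W"
    using H(2) W(1) unfolding totally_bounded_group_def by blast
  then show "finite_small_cover G V"
    unfolding W(2) G(2) by (rule finite_small_cover_hom_preimage[OF G(1) H(1) f(1)])
qed

section \<open>Modules over topological rings\<close>

context left_module
begin

lemma smult_left_hom: "x \<in> carrier M \<Longrightarrow> (\<lambda>r. r \<odot>\<^bsub>M\<^esub> x) \<in> hom (add_monoid R) (add_monoid M)"
  by (auto simp: hom_def smult_l_distr)

lemma smult_zero_left: "x \<in> carrier M \<Longrightarrow> \<zero> \<odot>\<^bsub>M\<^esub> x = \<zero>\<^bsub>M\<^esub>"
  using hom_one[OF smult_left_hom R.a_group M.a_group] by simp

lemma smult_zero_right:
  assumes "r \<in> carrier R"
  shows "r \<odot>\<^bsub>M\<^esub> \<zero>\<^bsub>M\<^esub> = \<zero>\<^bsub>M\<^esub>"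
proof -
  have "(\<lambda>x. r \<odot>\<^bsub>M\<^esub> x) \<in> hom (add_monoid M) (add_monoid M)"
    using assms by (auto simp: hom_def smult_r_distr)
  from hom_one[OF this M.a_group M.a_group] show ?thesis by simp
qed

text \<open>
  Both terms on the right are small as soon as \<open>r\<close> and \<open>r \<otimes> s \<ominus> \<one>\<close> are small in a
  sense that is uniform on \<open>M\<close>; so \<open>r\<close> can play the role of a small unit with inverse \<open>s\<close>.
\<close>

lemma eq_smult_approx_inverse_diff:
  assumes "r \<in> carrier R" "s \<in> carrier R" "x \<in> carrier M"
  shows "x = r \<odot>\<^bsub>M\<^esub> (s \<odot>\<^bsub>M\<^esub> x) \<ominus>\<^bsub>M\<^esub> (r \<otimes> s \<ominus> \<one>) \<odot>\<^bsub>M\<^esub> x"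
proof -
  let ?t = "r \<otimes> s \<ominus> \<one>"
  have "r \<odot>\<^bsub>M\<^esub> (s \<odot>\<^bsub>M\<^esub> x) = (\<one> \<oplus> ?t) \<odot>\<^bsub>M\<^esub> x"
    using assms by (simp add: smult_assoc1[symmetric] R.minus_eq R.a_lcomm[of "\<one>" "r \<otimes> s"] R.r_neg)
  also have "\<dots> = x \<oplus>\<^bsub>M\<^esub> ?t \<odot>\<^bsub>M\<^esub> x"
    using assms by (simp add: smult_l_distr)
  finally show ?thesis
    using assms by (simp add: M.minus_eq M.a_assoc M.r_neg)
qed

end

text \<open>
  Near zero in both variables this is the continuity of the action; total boundedness leaves
  finitely many further elements \<open>p\<close> of \<open>M\<close> to be controlled, and each of them is taken care of
  by the continuity of \<open>r \<mapsto> r * p\<close>.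
\<close>

lemma totally_bounded_module_bounded:
  fixes M :: "('r, 'x, 'n) module_scheme"
  assumes TR: "topspace TR = carrier R" and M: "topological_module R TR M TM"
    and tb: "totally_bounded_group (add_monoid M) TM"
    and U: "openin TM U" "\<zero>\<^bsub>M\<^esub> \<in> U"
  obtains V where "openin TR V" "\<zero>\<^bsub>R\<^esub> \<in> V"
    "\<And>r x. r \<in> V \<Longrightarrow> x \<in> carrier M \<Longrightarrow> r \<odot>\<^bsub>M\<^esub> x \<in> U"
proof -
  interpret left_module R M using M unfolding topological_module_def by blast
  interpret G: topological_group "add_monoid M" TM
    using M unfolding topological_module_def by blast
  have act: "continuous_map (prod_topology TR TM) TM (\<lambda>(r, x). r \<odot>\<^bsub>M\<^esub> x)"
    using M unfolding topological_module_def by blast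
  have TM: "topspace TM = carrier M" using G.topspace_eq by simp
  have add: "continuous_map (prod_topology TM TM) TM (\<lambda>(x, y). x \<oplus>\<^bsub>M\<^esub> y)"
    using G.continuous_mult by simp
  obtain U1 U2 where U12: "openin TM U1" "openin TM U2" "\<zero>\<^bsub>M\<^esub> \<in> U1" "\<zero>\<^bsub>M\<^esub> \<in> U2"
    "\<And>x y. x \<in> U1 \<Longrightarrow> y \<in> U2 \<Longrightarrow> x \<oplus>\<^bsub>M\<^esub> y \<in> U"
    using continuous_map_binary_neighborhoods[OF add, of "\<zero>\<^bsub>M\<^esub>" "\<zero>\<^bsub>M\<^esub>" U] U TM by auto
  obtain V0 W where V0: "openin TR V0" "openin TM W" "\<zero>\<^bsub>R\<^esub> \<in> V0" "\<zero>\<^bsub>M\<^esub> \<in> W"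
    "\<And>r y. r \<in> V0 \<Longrightarrow> y \<in> W \<Longrightarrow> r \<odot>\<^bsub>M\<^esub> y \<in> U1"
    using continuous_map_binary_neighborhoods[OF act, of "\<zero>\<^bsub>R\<^esub>" "\<zero>\<^bsub>M\<^esub>" U1]
      U12 TM TR smult_zero_right by auto
  have "finite_small_cover (add_monoid M) W"
    using tb V0 unfolding totally_bounded_group_def by simp
  then obtain \<A> where A: "finite \<A>" "\<Union>\<A> = carrier M"
    "\<forall>A \<in> \<A>. \<forall>x \<in> A. \<forall>y \<in> A. x \<ominus>\<^bsub>M\<^esub> y \<in> W"
    unfolding finite_small_cover_def a_minus_def a_inv_def partial_object.simps monoid.simps by meson
  \<comment> \<open>Below, the empty set is removed from the cover, since \<open>p {}\<close> need not lie in \<open>M\<close>.\<close>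
  define p where "p A = (SOME x. x \<in> A)" for A :: "'x set"
  have p: "p A \<in> A" if "x \<in> A" for A x
    using that unfolding p_def by (rule someI)
  define Q where "Q A = {r \<in> topspace TR. r \<odot>\<^bsub>M\<^esub> p A \<in> U2}" for A
  have Q: "openin TR (Q A)" "\<zero>\<^bsub>R\<^esub> \<in> Q A" if "A \<in> \<A> - {{}}" for A
  proof -
    have pM: "p A \<in> carrier M" using that p A(2) by blast
    have "continuous_map TR (prod_topology TR TM) (\<lambda>r. (r, p A))"
      using pM TM by (intro continuous_map_pairedI) auto
    from continuous_map_compose[OF this act]
    have "continuous_map TR TM (\<lambda>r. r \<odot>\<^bsub>M\<^esub> p A)" by (simp add: o_def)
    then show "openin TR (Q A)"
      unfolding Q_def using U12(2) by (rule openin_continuous_map_preimage)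
    show "\<zero>\<^bsub>R\<^esub> \<in> Q A"
      using pM TR U12 by (simp add: Q_def smult_zero_left)
  qed
  let ?V = "\<Inter> (insert V0 (Q ` (\<A> - {{}})))"
  show ?thesis
  proof (rule that)
    show "openin TR ?V" using Q V0 A(1) by (intro openin_Inter) auto
    show "\<zero>\<^bsub>R\<^esub> \<in> ?V" using Q V0 by auto
    fix r x assume r: "r \<in> ?V" and x: "x \<in> carrier M"
    then obtain A where "A \<in> \<A>" "x \<in> A" using A(2) by blast
    moreover from this have pA: "p A \<in> A" by (blast intro: p)
    ultimately have W: "x \<ominus>\<^bsub>M\<^esub> p A \<in> W" and Qr: "r \<in> Q A" and pM: "p A \<in> carrier M"
      using A r by auto
    have rR: "r \<in> carrier R" using Qr TR by (simp add: Q_def)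
    have "r \<odot>\<^bsub>M\<^esub> (x \<ominus>\<^bsub>M\<^esub> p A) \<oplus>\<^bsub>M\<^esub> r \<odot>\<^bsub>M\<^esub> p A \<in> U"
      using r W Qr by (intro U12(5) V0(5)) (auto simp: Q_def)
    moreover have "r \<odot>\<^bsub>M\<^esub> (x \<ominus>\<^bsub>M\<^esub> p A) \<oplus>\<^bsub>M\<^esub> r \<odot>\<^bsub>M\<^esub> p A = r \<odot>\<^bsub>M\<^esub> x"
      using rR x pM
      by (simp add: smult_r_distr[symmetric] M.minus_eq M.a_assoc M.l_neg)
    ultimately show "r \<odot>\<^bsub>M\<^esub> x \<in> U" by simp
  qed
qed

section \<open>Triviality of totally bounded modules\<close>

text \<open>
  A unit \<open>u\<close> of the larger ring near zero and its inverse satisfy \<open>u * inv u - 1 = 0\<close>. By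
  continuity, elements of the dense subring that are close to \<open>u\<close> and \<open>inv u\<close> satisfy this equation
  approximately.
\<close>

lemma dense_in_crowded_approx_inverse:
  assumes C: "topological_ring C TC" "crowded C TC" and R: "ring R" "topspace TR = carrier R"
    and i: "i \<in> ring_hom R C" "embedding_map TR TC i"
      "TC closure_of (i ` carrier R) = carrier C"
    and V: "openin TR V" "\<zero>\<^bsub>R\<^esub> \<in> V"
  obtains r s where "r \<in> V" "s \<in> carrier R" "r \<otimes>\<^bsub>R\<^esub> s \<ominus>\<^bsub>R\<^esub> \<one>\<^bsub>R\<^esub> \<in> V"
proof -
  interpret C: topological_ring C TC by fact
  interpret ih: ring_hom_ring R C i
    using i(1) R(1) C.ring_axioms by (simp add: ring_hom_ring_def ring_hom_ring_axioms_def)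
  obtain W where W: "openin TC W" "V = {r \<in> topspace TR. i r \<in> W}"
    using embedding_map_open_is_preimage[OF i(2) V(1)] by metis
  then have "\<zero>\<^bsub>C\<^esub> \<in> W" using V(2) by simp
  then obtain u where u: "u \<in> W" "u \<in> Units C"
    using C(2) W(1) unfolding crowded_def by blast
  have uC: "u \<in> carrier C" "inv\<^bsub>C\<^esub> u \<in> carrier C"
    using u(2) by auto
  have "continuous_map TC (prod_topology TC TC) (\<lambda>c. (c, \<ominus>\<^bsub>C\<^esub> \<one>\<^bsub>C\<^esub>))"
    using C.topspace_eq by (intro continuous_map_pairedI) auto
  from continuous_map_compose[OF this C.continuous_add]
  have "continuous_map TC TC (\<lambda>c. c \<ominus>\<^bsub>C\<^esub> \<one>\<^bsub>C\<^esub>)" by (simp add: o_def C.minus_eq)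
  from continuous_map_compose[OF C.continuous_mult this]
  have "continuous_map (prod_topology TC TC) TC (\<lambda>(a, b). a \<otimes>\<^bsub>C\<^esub> b \<ominus>\<^bsub>C\<^esub> \<one>\<^bsub>C\<^esub>)"
    by (simp add: o_def split_def)
  moreover have "u \<otimes>\<^bsub>C\<^esub> inv\<^bsub>C\<^esub> u \<ominus>\<^bsub>C\<^esub> \<one>\<^bsub>C\<^esub> \<in> W"
    using \<open>\<zero>\<^bsub>C\<^esub> \<in> W\<close> u(2) by (simp add: C.minus_eq C.r_neg)
  ultimately obtain A B where AB: "openin TC A" "openin TC B" "u \<in> A" "inv\<^bsub>C\<^esub> u \<in> B"
    "\<And>a b. a \<in> A \<Longrightarrow> b \<in> B \<Longrightarrow> a \<otimes>\<^bsub>C\<^esub> b \<ominus>\<^bsub>C\<^esub> \<one>\<^bsub>C\<^esub> \<in> W"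
    using continuous_map_binary_neighborhoods[where x = u and y = "inv\<^bsub>C\<^esub> u" and W = W
        and S = TC and T = TC and Z = TC and f = "\<lambda>a b. a \<otimes>\<^bsub>C\<^esub> b \<ominus>\<^bsub>C\<^esub> \<one>\<^bsub>C\<^esub>"]
      uC C.topspace_eq W(1) by metis
  have dense: "\<exists>r \<in> carrier R. i r \<in> N" if "openin TC N" "c \<in> N" "c \<in> carrier C" for N c
    using that i(3) by (auto simp: set_eq_iff in_closure_of)
  obtain r where r: "r \<in> carrier R" "i r \<in> A \<inter> W"
    using dense[of "A \<inter> W" u] AB W(1) u(1) uC by auto
  obtain s where s: "s \<in> carrier R" "i s \<in> B"
    using dense[of B "inv\<^bsub>C\<^esub> u"] AB uC by auto
  have "i (r \<otimes>\<^bsub>R\<^esub> s \<ominus>\<^bsub>R\<^esub> \<one>\<^bsub>R\<^esub>) = i r \<otimes>\<^bsub>C\<^esub> i s \<ominus>\<^bsub>C\<^esub> \<one>\<^bsub>C\<^esub>"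
    using r s by (simp add: ih.R.minus_eq C.minus_eq)
  then have "r \<otimes>\<^bsub>R\<^esub> s \<ominus>\<^bsub>R\<^esub> \<one>\<^bsub>R\<^esub> \<in> V"
    using AB(5) r s W(2) R(2) by (simp add: ih.R.minus_eq)
  then show ?thesis using r s W(2) R(2) by (intro that[of r s]) auto
qed

lemma totally_bounded_module_trivial:
  fixes M :: "('r, 'x, 'n) module_scheme"
  assumes C: "topological_ring C TC" "crowded C TC" and TR: "topspace TR = carrier R"
    and i: "i \<in> ring_hom R C" "embedding_map TR TC i"
      "TC closure_of (i ` carrier R) = carrier C"
    and M: "topological_module R TR M TM"
    and tb: "totally_bounded_group (add_monoid M) TM"
  shows "carrier M = {\<zero>\<^bsub>M\<^esub>}"
proof -
  interpret left_module R M using M unfolding topological_module_def by blast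
  interpret G: topological_group "add_monoid M" TM
    using M unfolding topological_module_def by blast
  have TM: "topspace TM = carrier M" using G.topspace_eq by simp
  have diff: "continuous_map (prod_topology TM TM) TM (\<lambda>(x, y). x \<ominus>\<^bsub>M\<^esub> y)"
    using G.continuous_div by (simp add: a_inv_def a_minus_def)
  have in_nbhd: "x \<in> U" if x: "x \<in> carrier M" and U: "openin TM U" "\<zero>\<^bsub>M\<^esub> \<in> U" for x U
  proof -
    have "\<zero>\<^bsub>M\<^esub> \<ominus>\<^bsub>M\<^esub> \<zero>\<^bsub>M\<^esub> \<in> U" using U by (simp only: M.minus_eq M.r_neg M.zero_closed)
    then obtain U1 U2 where U12: "openin TM U1" "openin TM U2" "\<zero>\<^bsub>M\<^esub> \<in> U1" "\<zero>\<^bsub>M\<^esub> \<in> U2"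
      "\<And>x y. x \<in> U1 \<Longrightarrow> y \<in> U2 \<Longrightarrow> x \<ominus>\<^bsub>M\<^esub> y \<in> U"
      using continuous_map_binary_neighborhoods[OF diff, of "\<zero>\<^bsub>M\<^esub>" "\<zero>\<^bsub>M\<^esub>" U] U TM by auto
    have "openin TM (U1 \<inter> U2)" "\<zero>\<^bsub>M\<^esub> \<in> U1 \<inter> U2" using U12 by auto
    then obtain V where V: "openin TR V" "\<zero>\<^bsub>R\<^esub> \<in> V"
      "\<And>r x. r \<in> V \<Longrightarrow> x \<in> carrier M \<Longrightarrow> r \<odot>\<^bsub>M\<^esub> x \<in> U1 \<inter> U2"
      using totally_bounded_module_bounded[OF TR M tb] by metis
    obtain r s where rs: "r \<in> V" "s \<in> carrier R" "r \<otimes>\<^bsub>R\<^esub> s \<ominus>\<^bsub>R\<^esub> \<one>\<^bsub>R\<^esub> \<in> V"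
      using dense_in_crowded_approx_inverse[OF C R.ring_axioms TR i V(1,2)] by metis
    have "r \<in> carrier R" using rs(1) openin_subset[OF V(1)] TR by blast
    moreover have "r \<odot>\<^bsub>M\<^esub> (s \<odot>\<^bsub>M\<^esub> x) \<ominus>\<^bsub>M\<^esub> (r \<otimes>\<^bsub>R\<^esub> s \<ominus>\<^bsub>R\<^esub> \<one>\<^bsub>R\<^esub>) \<odot>\<^bsub>M\<^esub> x \<in> U"
      using V(3)[OF rs(1), of "s \<odot>\<^bsub>M\<^esub> x"] V(3)[OF rs(3) x] rs(2) x by (intro U12(5)) auto
    ultimately show ?thesis
      using eq_smult_approx_inverse_diff[of r s x] rs(2) x by simp
  qed
  have "x = \<zero>\<^bsub>M\<^esub>" if x: "x \<in> carrier M" for x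
  proof (rule ccontr)
    assume "x \<noteq> \<zero>\<^bsub>M\<^esub>"
    moreover have "Hausdorff_space TM" using M unfolding topological_module_def by blast
    ultimately obtain U V where "openin TM U" "\<zero>\<^bsub>M\<^esub> \<in> U" "x \<in> V" "disjnt U V"
      using x TM unfolding Hausdorff_space_def by (metis M.zero_closed)
    then show False using in_nbhd[OF x] by (auto simp: disjnt_iff)
  qed
  then show ?thesis by auto
qed

definition regular_module :: "('r, 'm) ring_scheme \<Rightarrow> ('r, 'r) module" where
  "regular_module R = \<lparr>carrier = carrier R, monoid.mult = (\<otimes>\<^bsub>R\<^esub>), one = \<one>\<^bsub>R\<^esub>,
     zero = \<zero>\<^bsub>R\<^esub>, add = (\<oplus>\<^bsub>R\<^esub>), smult = (\<otimes>\<^bsub>R\<^esub>)\<rparr>"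

lemma (in ring) left_module_regular_module: "left_module R (regular_module R)"
proof (intro left_module.intro left_module_axioms.intro ring_axioms)
  show "abelian_group (regular_module R)"
    by (rule abelian_groupI)
      (auto simp: regular_module_def a_ac intro: bexI[of _ "\<ominus> _"] l_neg)
qed (auto simp: regular_module_def l_distr r_distr m_assoc)

lemma (in topological_ring) topological_module_regular_module:
  "topological_module R T (regular_module R) T"
proof -
  interpret M: left_module R "regular_module R" by (rule left_module_regular_module)
  \<comment> \<open>The axioms of a topological ring yield the continuity of negation as that of the
    multiplication by \<open>\<ominus> \<one>\<close>.\<close>
  have "continuous_map T (prod_topology T T) (\<lambda>x. (\<ominus> \<one>, x))"
    using topspace_eq by (intro continuous_map_pairedI) auto
  from continuous_map_compose[OF this continuous_mult]
  have neg: "continuous_map T T (\<lambda>x. \<ominus> \<one> \<otimes> x)" by (simp add: o_def)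
  have inv: "inv\<^bsub>add_monoid (regular_module R)\<^esub> x = \<ominus> \<one> \<otimes> x" if "x \<in> carrier R" for x
    using that
    by (intro group.inv_equality[OF M.M.a_group]) (auto simp: regular_module_def l_minus l_neg)
  have "topological_group (add_monoid (regular_module R)) T"
  proof (intro topological_group.intro topological_group_axioms.intro M.M.a_group)
    show "continuous_map T T (\<lambda>x. inv\<^bsub>add_monoid (regular_module R)\<^esub> x)"
      by (rule continuous_map_eq[OF neg]) (simp add: topspace_eq inv)
  qed (use topspace_eq continuous_add in \<open>auto simp: regular_module_def\<close>)
  then show ?thesis
    unfolding topological_module_def
    using left_module_regular_module Hausdorff continuous_mult by (simp add: regular_module_def)
qed

theorem theorem4p4:
  fixes R :: "('r, 'm) ring_scheme" and TR :: "'r topology"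
    and X :: "('r, 'x, 'n) module_scheme" and TX :: "'x topology"
    and C :: "('c, 'k) ring_scheme" and TC :: "'c topology" and i :: "'r \<Rightarrow> 'c"
  assumes "topological_ring R TR"
    and "semitopological_module R TR X TX"
    and "carrier X \<noteq> {\<zero>\<^bsub>X\<^esub>}"
    and "bohr_separated (add_monoid X) TX"
    and "is_completion R TR C TC i"
    and "overcrowded C TC"
  shows "\<not> topological_module R TR X (bohr_topology (add_monoid X) TX) \<and>
    (\<forall>x \<in> carrier X. x \<noteq> \<zero>\<^bsub>X\<^esub> \<longrightarrow>
       \<not> embedding_map TR (bohr_topology (add_monoid X) TX) (\<lambda>r. r \<odot>\<^bsub>X\<^esub> x))"
proof -
  interpret R: topological_ring R TR by fact
  interpret left_module R X using assms(2) unfolding semitopological_module_def by blast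
  let ?B = "bohr_topology (add_monoid X) TX"
  have C: "topological_ring C TC" "crowded C TC"
    and i: "i \<in> ring_hom R C" "embedding_map TR TC i"
      "TC closure_of (i ` carrier R) = carrier C"
    using assms(5,6) unfolding is_completion_def overcrowded_def by simp_all
  note trivial = totally_bounded_module_trivial[OF C R.topspace_eq i]
  have tb: "totally_bounded_group (add_monoid X) ?B"
    by (rule totally_bounded_bohr_topology[OF M.a_group])
  have "\<not> topological_module R TR X ?B"
    using trivial tb assms(3) by blast
  moreover have "x = \<zero>\<^bsub>X\<^esub>"
    if x: "x \<in> carrier X" and emb: "embedding_map TR ?B (\<lambda>r. r \<odot>\<^bsub>X\<^esub> x)" for x
  proof -
    let ?M = "regular_module R"
    interpret M': left_module R ?M by (rule R.left_module_regular_module)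
    have "(\<lambda>r. r \<odot>\<^bsub>X\<^esub> x) \<in> hom (add_monoid ?M) (add_monoid X)"
      using smult_left_hom[OF x] by (simp add: hom_def regular_module_def)
    then have "totally_bounded_group (add_monoid ?M) TR"
      by (intro embedding_into_totally_bounded_group[OF M'.M.a_group _ M.a_group tb _ emb])
        (simp_all add: R.topspace_eq regular_module_def)
    then have "carrier ?M = {\<zero>\<^bsub>?M\<^esub>}"
      by (rule trivial[OF R.topological_module_regular_module])
    then have "\<one>\<^bsub>R\<^esub> = \<zero>\<^bsub>R\<^esub>"
      using R.one_closed by (simp add: regular_module_def)
    then show ?thesis
      using x smult_one smult_zero_left by metis
  qed
  ultimately show ?thesis by blast
qed

end
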